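(* Let $(X,d)$ be a compact metric space with $\operatorname{diam}(X)\le 1$. (1) If $(X,d)$ is bi-Hölder equivalent to an ultrametric space, then $R(X,d)<\infty$. (2) If $R(X,d)<\infty$ and $\mathcal{A}^*_p(X)\neq\emptyset$ for some $p\in(1,\infty)$, then $(X,d)$ is bi-Hölder equivalent to an ultrametric space.
   Context: A map $f:(X,d)\to(X',d')$ of metric spaces is Hölder of exponent $s>0$ if there is $c>0$ with $d'(f(x_1),f(x_2))\le c\,d(x_1,x_2)^s$ for all $x_1,x_2\in X$. It is bi-Hölder if it is Hölder of some exponent $s>0$, is injective, and its inverse $f(X)\to X$ is Hölder of some exponent $t>0$. A bi-Hölder equivalence is a surjective bi-Hölder map; two spaces are bi-Hölder equivalent if there is a bi-Hölder equivalence between them. An ultrametric space is a metric space with $d(x_1,x_2)\le\max\{d(x_1,x_3),d(x_2,x_3)\}$ for all $x_1,x_2,x_3$. Logarithmic ratio. A clopen partition of a compact metric space $(X,d)$ is a finite partition $\alpha=\{A_1,\dots,A_n\}$ of $X$ into nonempty clopen sets. Its diameter is $\delta(\alpha)=\max_i \operatorname{diam}(A_i)$ (and $\delta(\alpha)=0$ if $n=0$). Its gap is $\gamma(\alpha)=\min\{d(x,y): x\in A_i,\ y\in A_j,\ i\ne j\}$ if $n>1$, and $\gamma(\alpha)=\operatorname{diam}(X)$ if $n\le 1$ (with $\operatorname{diam}(\emptyset)=0$). Its logarithmic ratio $R(\alpha)\in[0,\infty]$ is $R(\alpha)=\log\gamma(\alpha)/\log\delta(\alpha)$ if $0<\delta(\alpha)<1$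 and $\gamma(\alpha)<1$; $R(\alpha)=0$ if $\delta(\alpha)=0$; and $R(\alpha)=+\infty$ if either $0<\delta(\alpha)<1$ and $\gamma(\alpha)\ge 1$, or $\delta(\alpha)\ge 1$. The logarithmic ratio of $(X,d)$ is $$R(X,d)=\lim_{r\to 0^+}\inf\{R(\alpha): \alpha \text{ is a clopen partition of } X \text{ with } \delta(\alpha)<r\}\in[0,\infty],$$ with $\inf\emptyset=+\infty$. The set $\mathcal{A}^*_p(X)$. For $p\in(1,\infty)$, $\mathcal{A}^*_p(X)$ is the set of all sequences $(\alpha_n)_{n\ge1}$ of clopen partitions of $X$ such that: $\lim_{n\to\infty}\delta(\alpha_n)=0$; $\alpha_{n+1}$ is a refinement of $\alpha_n$ for all $n\ge 1$; $\lim_{n\to\infty}R(\alpha_n)=R(X,d)$; and there is $a>0$ with $a\,\delta(\alpha_n)^p\le\delta(\alpha_{n+1})\le\delta(\alpha_n)$ for all $n\ge1$. *)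

theory Defs
  imports "HOL-Analysis.Analysis"
begin

section \<open>Hoelder maps and bi-Hoelder equivalence\<close>

definition hoelder_map :: "'a metric \<Rightarrow> 'b metric \<Rightarrow> real \<Rightarrow> ('a \<Rightarrow> 'b) \<Rightarrow> bool" where
  "hoelder_map X Y s f \<longleftrightarrow>
     s > 0 \<and> f \<in> mspace X \<rightarrow> mspace Y \<and>
     (\<exists>c>0. \<forall>x\<in>mspace X. \<forall>y\<in>mspace X. mdist Y (f x) (f y) \<le> c * mdist X x y powr s)"

definition bi_hoelder :: "'a metric \<Rightarrow> 'b metric \<Rightarrow> ('a \<Rightarrow> 'b) \<Rightarrow> bool" where
  "bi_hoelder X Y f \<longleftrightarrow>
     (\<exists>s>0. hoelder_map X Y s f) \<and> inj_on f (mspace X) \<and>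
     (\<exists>t>0. hoelder_map (submetric Y (f ` mspace X)) X t (inv_into (mspace X) f))"

definition bi_hoelder_equivalence :: "'a metric \<Rightarrow> 'b metric \<Rightarrow> ('a \<Rightarrow> 'b) \<Rightarrow> bool" where
  "bi_hoelder_equivalence X Y f \<longleftrightarrow> bi_hoelder X Y f \<and> f ` mspace X = mspace Y"

definition bi_hoelder_equivalent :: "'a metric \<Rightarrow> 'b metric \<Rightarrow> bool" where
  "bi_hoelder_equivalent X Y \<longleftrightarrow> (\<exists>f. bi_hoelder_equivalence X Y f)"

definition ultrametric :: "'a metric \<Rightarrow> bool" where
  "ultrametric X \<longleftrightarrow>
     (\<forall>x\<in>mspace X. \<forall>y\<in>mspace X. \<forall>z\<in>mspace X. mdist X x y \<le> max (mdist X x z) (mdist X y z))"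


section \<open>Clopen partitions and the logarithmic ratio\<close>

text \<open>The counterpart for \<open>'a metric\<close> of the library's type class constant \<^const>\<open>diameter\<close>.
  As there, the value is meaningful only for bounded sets.\<close>

definition mdiameter :: "'a metric \<Rightarrow> 'a set \<Rightarrow> real" where
  "mdiameter X S = (if S = {} then 0 else SUP (x, y)\<in>S \<times> S. mdist X x y)"

definition clopen_partition :: "'a metric \<Rightarrow> 'a set set \<Rightarrow> bool" where
  "clopen_partition X \<alpha> \<longleftrightarrow>
     finite \<alpha> \<and> partition_on (mspace X) \<alpha> \<and>
     (\<forall>A\<in>\<alpha>. openin (mtopology_of X) A \<and> closedin (mtopology_of X) A)"

definition part_diam :: "'a metric \<Rightarrow> 'a set set \<Rightarrow> real" where
  "part_diam X \<alpha> = (if \<alpha> = {} then 0 else Max (mdiameter X ` \<alpha>))"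

text \<open>For a clopen partition of a compact space the infimum below is attained, so it is a
  minimum, and it is positive.\<close>

definition part_gap :: "'a metric \<Rightarrow> 'a set set \<Rightarrow> real" where
  "part_gap X \<alpha> =
     (if card \<alpha> > 1
      then Inf {mdist X x y | x y A B. A \<in> \<alpha> \<and> B \<in> \<alpha> \<and> A \<noteq> B \<and> x \<in> A \<and> y \<in> B}
      else mdiameter X (mspace X))"

definition part_log_ratio :: "'a metric \<Rightarrow> 'a set set \<Rightarrow> ereal" where
  "part_log_ratio X \<alpha> =
     (if part_diam X \<alpha> = 0 then 0
      else if 0 < part_diam X \<alpha> \<and> part_diam X \<alpha> < 1 \<and> part_gap X \<alpha> < 1
           then ereal (ln (part_gap X \<alpha>) / ln (part_diam X \<alpha>))
      else \<infinity>)"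

text \<open>In \<^typ>\<open>ereal\<close> the infimum of the empty set is \<open>\<infinity>\<close>, as required here.\<close>

definition log_ratio_below :: "'a metric \<Rightarrow> real \<Rightarrow> ereal" where
  "log_ratio_below X r =
     (INF \<alpha>\<in>{\<alpha>. clopen_partition X \<alpha> \<and> part_diam X \<alpha> < r}. part_log_ratio X \<alpha>)"

definition log_ratio :: "'a metric \<Rightarrow> ereal" where
  "log_ratio X = Lim (at_right 0) (log_ratio_below X)"

text \<open>The limit always exists, by monotonicity.\<close>

lemma log_ratio_tendsto: "(log_ratio_below X \<longlongrightarrow> log_ratio X) (at_right 0)"
proof -
  have anti: "log_ratio_below X s \<le> log_ratio_below X r" if "r \<le> s" for r s
    unfolding log_ratio_below_def using that by (intro INF_superset_mono) auto
  have "(log_ratio_below X \<longlongrightarrow> (SUP r\<in>{0<..}. log_ratio_below X r)) (at_right 0)"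
  proof (rule increasing_tendsto)
    show "\<forall>\<^sub>F r in at_right 0. log_ratio_below X r \<le> (SUP r\<in>{0<..}. log_ratio_below X r)"
      using eventually_at_right_less[of "0::real"] by eventually_elim (auto intro: SUP_upper)
  next
    fix y assume "y < (SUP r\<in>{0<..}. log_ratio_below X r)"
    then obtain r0 where r0: "r0 > 0" "y < log_ratio_below X r0"
      by (auto simp: less_SUP_iff)
    have "\<forall>\<^sub>F r in at_right 0. r < r0"
      using r0(1) eventually_at_right_field by blast
    then show "\<forall>\<^sub>F r in at_right 0. y < log_ratio_below X r"
      by eventually_elim (use r0(2) anti in \<open>meson less_imp_le less_le_trans\<close>)
  qed
  then show ?thesis
    unfolding log_ratio_def by (metis tendsto_Lim trivial_limit_at_right_real)
qed


section \<open>The set $\mathcal{A}^*_p(X)$\<close>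

text \<open>Sequences are indexed from \<open>0\<close>: \<open>\<alpha> n\<close> is the \<open>(n+1)\<close>-st partition of the sequence.
  \<^const>\<open>refines\<close> takes the finer partition first.\<close>

definition A_star :: "real \<Rightarrow> 'a metric \<Rightarrow> (nat \<Rightarrow> 'a set set) set" where
  "A_star p X =
     {\<alpha>. (\<forall>n. clopen_partition X (\<alpha> n)) \<and>
         (\<lambda>n. part_diam X (\<alpha> n)) \<longlonglongrightarrow> 0 \<and>
         (\<forall>n. refines (mspace X) (\<alpha> (Suc n)) (\<alpha> n)) \<and>
         (\<lambda>n. part_log_ratio X (\<alpha> n)) \<longlonglongrightarrow> log_ratio X \<and>
         (\<exists>a>0. \<forall>n. a * part_diam X (\<alpha> n) powr p \<le> part_diam X (\<alpha> (Suc n)) \<and>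
                    part_diam X (\<alpha> (Suc n)) \<le> part_diam X (\<alpha> n))}"

end

theory Submission
  imports Defs
begin

text \<open>
  Both parts rest on comparing the distance of two points with the first scale at which they are
  separated. If \<open>d\<close> is bi-Hoelder comparable to an ultrametric \<open>\<rho>\<close>, then the partition into open
  \<open>\<rho>\<close>-balls of radius \<open>\<epsilon>\<close> has \<open>d\<close>-diameter at most a power of \<open>\<epsilon>\<close> and \<open>d\<close>-gap at least a power
  of \<open>\<epsilon>\<close>, so its logarithmic ratio stays bounded as \<open>\<epsilon> \<rightarrow> 0\<close>. Conversely, let \<open>\<rho> x y = \<delta> (\<alpha> m)\<close>
  where \<open>m\<close> is the first index at which \<open>\<alpha> m\<close> separates \<open>x\<close> and \<open>y\<close>. This is an ultrametric;
  separation by \<open>\<alpha> m\<close> gives \<open>d x y \<ge> \<gamma> (\<alpha> m) \<ge> \<rho> x y powr K\<close> for any \<open>K\<close> above the logarithmic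
  ratio, while non-separation by \<open>\<alpha> (m - 1)\<close> gives
  \<open>d x y \<le> \<delta> (\<alpha> (m - 1)) \<le> (\<rho> x y / a) powr (1 / p)\<close>.
\<close>

section \<open>Diameter and gap of partitions\<close>

lemma mdist_self [simp]: "x \<in> mspace X \<Longrightarrow> mdist X x x = 0"
  by simp

lemma mdist_bounded_of_compact:
  assumes "compact_space (mtopology_of X)"
  obtains B where "\<And>x y. \<lbrakk>x \<in> mspace X; y \<in> mspace X\<rbrakk> \<Longrightarrow> mdist X x y \<le> B"
proof -
  interpret Metric_space "mspace X" "mdist X"
    by simp
  have "mbounded (mspace X)"
    using assms compactin_imp_mbounded by (simp add: mtopology_of_def compact_space_def)
  then show ?thesis
    using that by (auto simp: mbounded_alt)
qed

text \<open>Compactness bounds the metric, so the supremum in \<open>mdiameter\<close> is a genuine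
  upper bound.\<close>

lemma mdist_le_mdiameter:
  assumes "compact_space (mtopology_of X)" "S \<subseteq> mspace X" "x \<in> S" "y \<in> S"
  shows "mdist X x y \<le> mdiameter X S"
proof -
  obtain B where B: "\<And>x y. \<lbrakk>x \<in> mspace X; y \<in> mspace X\<rbrakk> \<Longrightarrow> mdist X x y \<le> B"
    using mdist_bounded_of_compact[OF assms(1)] by blast
  have "bdd_above ((\<lambda>(x, y). mdist X x y) ` (S \<times> S))"
    using B assms(2) by (intro bdd_aboveI[of _ B]) auto
  then have "(\<lambda>(x, y). mdist X x y) (x, y) \<le> (SUP (x, y)\<in>S \<times> S. mdist X x y)"
    by (intro cSUP_upper) (use assms in auto)
  then show ?thesis
    using assms(3) by (auto simp: mdiameter_def)
qed

lemma mdiameter_le: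
  assumes "0 \<le> C" "\<And>x y. \<lbrakk>x \<in> S; y \<in> S\<rbrakk> \<Longrightarrow> mdist X x y \<le> C"
  shows "mdiameter X S \<le> C"
proof (cases "S = {}")
  case False
  then have "(SUP (x, y)\<in>S \<times> S. mdist X x y) \<le> C"
    by (intro cSUP_least) (use assms in auto)
  then show ?thesis
    using False by (simp add: mdiameter_def)
qed (simp add: mdiameter_def assms)

lemma clopen_partition_subset:
  assumes "clopen_partition X \<alpha>" "A \<in> \<alpha>"
  shows "A \<subseteq> mspace X"
  using assms by (auto simp: clopen_partition_def partition_on_def)

lemma clopen_partition_cover:
  assumes "clopen_partition X \<alpha>" "x \<in> mspace X"
  obtains A where "A \<in> \<alpha>" "x \<in> A"
  using assms unfolding clopen_partition_def partition_on_def by blast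

lemma mdist_le_part_diam:
  assumes "compact_space (mtopology_of X)" "clopen_partition X \<alpha>" "A \<in> \<alpha>" "x \<in> A" "y \<in> A"
  shows "mdist X x y \<le> part_diam X \<alpha>"
proof -
  have "mdist X x y \<le> mdiameter X A"
    using assms clopen_partition_subset by (intro mdist_le_mdiameter) auto
  also have "\<dots> \<le> Max (mdiameter X ` \<alpha>)"
    using assms by (intro Max_ge) (auto simp: clopen_partition_def)
  finally show ?thesis
    using assms(3) by (auto simp: part_diam_def)
qed

lemma part_diam_nonneg:
  assumes "compact_space (mtopology_of X)" "clopen_partition X \<alpha>"
  shows "0 \<le> part_diam X \<alpha>"
proof (cases "\<alpha> = {}")
  case False
  then obtain A where A: "A \<in> \<alpha>"
    by blast
  then have "A \<noteq> {}"
    using assms(2) by (auto simp: clopen_partition_def partition_on_def)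
  then obtain x where "x \<in> A"
    by blast
  then have "mdist X x x \<le> part_diam X \<alpha>"
    using mdist_le_part_diam[OF assms A] by blast
  then show ?thesis
    using mdist_nonneg[of X x x] by linarith
qed (simp add: part_diam_def)

lemma part_diam_le:
  assumes "finite \<alpha>" "0 \<le> C" "\<And>A x y. \<lbrakk>A \<in> \<alpha>; x \<in> A; y \<in> A\<rbrakk> \<Longrightarrow> mdist X x y \<le> C"
  shows "part_diam X \<alpha> \<le> C"
proof (cases "\<alpha> = {}")
  case False
  then have "Max (mdiameter X ` \<alpha>) \<le> C"
    using assms by (auto intro!: mdiameter_le)
  then show ?thesis
    using False by (simp add: part_diam_def)
qed (simp add: part_diam_def assms)

lemma card_gt_1I:
  assumes "finite \<alpha>" "A \<in> \<alpha>" "B \<in> \<alpha>" "A \<noteq> B"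
  shows "card \<alpha> > 1"
proof -
  have "card {A, B} \<le> card \<alpha>"
    using assms by (intro card_mono) auto
  then show ?thesis
    using assms(4) by simp
qed

lemma part_gap_le_mdist:
  assumes "finite \<alpha>" "A \<in> \<alpha>" "B \<in> \<alpha>" "A \<noteq> B" "x \<in> A" "y \<in> B"
  shows "part_gap X \<alpha> \<le> mdist X x y"
proof -
  have "bdd_below {mdist X x y | x y A B. A \<in> \<alpha> \<and> B \<in> \<alpha> \<and> A \<noteq> B \<and> x \<in> A \<and> y \<in> B}"
    by (intro bdd_belowI[of _ 0]) auto
  then have "Inf {mdist X x y | x y A B. A \<in> \<alpha> \<and> B \<in> \<alpha> \<and> A \<noteq> B \<and> x \<in> A \<and> y \<in> B} \<le> mdist X x y"
    by (rule cInf_lower[rotated]) (use assms in blast)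
  then show ?thesis
    using card_gt_1I[OF assms(1-4)] by (simp add: part_gap_def)
qed

lemma part_gap_ge:
  assumes "partition_on M \<alpha>" "card \<alpha> > 1"
    and "\<And>A B x y. \<lbrakk>A \<in> \<alpha>; B \<in> \<alpha>; A \<noteq> B; x \<in> A; y \<in> B\<rbrakk> \<Longrightarrow> e \<le> mdist X x y"
  shows "e \<le> part_gap X \<alpha>"
proof -
  \<comment> \<open>A lower bound passes to a real infimum only over a nonempty set, so two distinct
    nonempty cells are exhibited first.\<close>
  obtain A B where AB: "A \<in> \<alpha>" "B \<in> \<alpha>" "A \<noteq> B"
    using assms(2) card_le_Suc0_iff_eq[of \<alpha>] by (metis One_nat_def card.infinite not_less zero_le)
  then have "A \<noteq> {}" "B \<noteq> {}"
    using assms(1) by (auto simp: partition_on_def)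
  then obtain x y where "x \<in> A" "y \<in> B"
    by blast
  with AB have "{mdist X x y | x y A B. A \<in> \<alpha> \<and> B \<in> \<alpha> \<and> A \<noteq> B \<and> x \<in> A \<and> y \<in> B} \<noteq> {}"
    by blast
  then have "e \<le> Inf {mdist X x y | x y A B. A \<in> \<alpha> \<and> B \<in> \<alpha> \<and> A \<noteq> B \<and> x \<in> A \<and> y \<in> B}"
    by (rule cInf_greatest) (use assms(3) in blast)
  then show ?thesis
    using assms(2) by (simp add: part_gap_def)
qed

text \<open>The cells form an open cover. If \<open>e\<close> is a Lebesgue number of it, every
  \<open>e\<close>-ball lies in a single cell, so points of different cells are at distance at least
  \<open>e\<close>.\<close>

lemma part_gap_pos:
  assumes "compact_space (mtopology_of X)" "clopen_partition X \<alpha>" "card \<alpha> > 1"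
  shows "0 < part_gap X \<alpha>"
proof -
  interpret Metric_space "mspace X" "mdist X"
    by simp
  have part: "partition_on (mspace X) \<alpha>"
    using assms(2) by (simp add: clopen_partition_def)
  have "\<exists>e>0. \<forall>x\<in>mspace X. \<exists>U\<in>\<alpha>. mball x e \<subseteq> U"
    using assms(1,2) by (intro lebesgue_number)
      (auto simp: clopen_partition_def partition_on_def compact_space_def mtopology_of_def)
  then obtain e where e: "e > 0" "\<And>x. x \<in> mspace X \<Longrightarrow> \<exists>U\<in>\<alpha>. mball x e \<subseteq> U"
    by blast
  have "e \<le> mdist X x y" if "A \<in> \<alpha>" "B \<in> \<alpha>" "A \<noteq> B" "x \<in> A" "y \<in> B" for A B x y
  proof (rule ccontr)
    assume "\<not> e \<le> mdist X x y"
    moreover have M: "x \<in> mspace X" "y \<in> mspace X"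
      using that assms(2) clopen_partition_subset by blast+
    ultimately have "x \<in> mball x e" "y \<in> mball x e"
      using e(1) by auto
    with e(2)[OF M(1)] obtain U where "U \<in> \<alpha>" "x \<in> U" "y \<in> U"
      by blast
    with that part show False
      by (metis disjnt_iff pairwiseD partition_onD2)
  qed
  then have "e \<le> part_gap X \<alpha>"
    using part assms(3) part_gap_ge by metis
  with e(1) show ?thesis
    by linarith
qed

section \<open>Clopen partitions from equivalence relations\<close>

text \<open>Each class and its complement contain the \<open>e\<close>-ball around each of their
  points, so classes are clopen. Every class contains a point of a finite \<open>e\<close>-net,
  which bounds their number.\<close>

lemma clopen_partition_quotient:
  assumes "compact_space (mtopology_of X)" "equiv (mspace X) r" "e > 0"
    and "\<And>x y. \<lbrakk>x \<in> mspace X; y \<in> mspace X; mdist X x y < e\<rbrakk> \<Longrightarrow> (x, y) \<in> r"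
  shows "clopen_partition X (mspace X // r)"
proof -
  interpret Metric_space "mspace X" "mdist X"
    by simp
  have part: "partition_on (mspace X) (mspace X // r)"
    using assms(2) by (rule partition_on_quotient)
  \<comment> \<open>Stated for arbitrary saturated sets, since it serves both for a class and for
    its complement.\<close>
  have opn: "openin mtopology A" if "A \<subseteq> mspace X"
    and A: "\<And>x y. \<lbrakk>x \<in> A; (x, y) \<in> r\<rbrakk> \<Longrightarrow> y \<in> A" for A
    unfolding openin_mtopology
  proof (intro conjI allI impI exI)
    fix x assume "x \<in> A"
    with that assms(4) show "mball x e \<subseteq> A"
      by auto
  qed (use that assms(3) in auto)
  have sym: "sym r"
    using assms(2) by (auto elim: equivE)
  have closed: "y \<in> A" if "A \<in> mspace X // r" "x \<in> A" "(x, y) \<in> r" for A x y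
    using that assms(2) by (metis in_quotient_imp_closed)
  have "openin mtopology A \<and> closedin mtopology A" if A: "A \<in> mspace X // r" for A
  proof
    have sub: "A \<subseteq> mspace X"
      using A part by (auto simp: partition_on_def)
    then show "openin mtopology A"
      using closed[OF A] by (intro opn)
    have "openin mtopology (mspace X - A)"
      using closed[OF A] symD[OF sym] assms(2)
      by (intro opn) (auto simp: equiv_def refl_on_def)
    with sub show "closedin mtopology A"
      by (simp add: closedin_def)
  qed
  moreover have "finite (mspace X // r)"
  proof -
    have "mtotally_bounded (mspace X)"
      using assms(1) by (simp add: mtopology_of_def compact_space_eq_mcomplete_mtotally_bounded)
    with \<open>e > 0\<close> obtain K where K: "finite K" "K \<subseteq> mspace X" "mspace X \<subseteq> (\<Union>x\<in>K. mball x e)"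
      unfolding mtotally_bounded_def by meson
    have "mspace X // r \<subseteq> (\<lambda>x. r `` {x}) ` K"
    proof
      fix A assume "A \<in> mspace X // r"
      then obtain y where y: "y \<in> mspace X" "A = r `` {y}"
        by (auto elim: quotientE)
      with K obtain x where x: "x \<in> K" "y \<in> mball x e"
        by blast
      then have "(x, y) \<in> r"
        using assms(4) by auto
      then have "r `` {x} = A"
        using assms(2) y equiv_class_eq by metis
      with x show "A \<in> (\<lambda>x. r `` {x}) ` K"
        by blast
    qed
    with K(1) show ?thesis
      by (meson finite_imageI finite_subset)
  qed
  ultimately show ?thesis
    using part by (simp add: clopen_partition_def mtopology_of_def)
qed

section \<open>Logarithmic ratios as power inequalities\<close>

lemma part_log_ratio_le:
  assumes "0 < part_diam X \<alpha>" "part_diam X \<alpha> < 1" "part_gap X \<alpha> < 1"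
    and "part_diam X \<alpha> powr K \<le> part_gap X \<alpha>"
  shows "part_log_ratio X \<alpha> \<le> ereal K"
proof -
  have "K * ln (part_diam X \<alpha>) = ln (part_diam X \<alpha> powr K)"
    using assms(1) by simp
  also have "\<dots> \<le> ln (part_gap X \<alpha>)"
    using assms by (subst ln_le_cancel_iff) (auto intro: less_le_trans[of _ "part_diam X \<alpha> powr K"])
  \<comment> \<open>The denominator is negative because the diameter is below 1, so dividing
    reverses the inequality.\<close>
  finally have "ln (part_gap X \<alpha>) / ln (part_diam X \<alpha>) \<le> K"
    using assms by (simp add: divide_le_eq)
  then show ?thesis
    using assms by (simp add: part_log_ratio_def)
qed

text \<open>A finite bound on the ratio rules out the value \<open>\<infinity>\<close>, and positive
  diameter rules out the default 0. Hence the ratio is the quotient of logarithms, with a negative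
  denominator.\<close>

lemma powr_le_part_gap:
  assumes "part_log_ratio X \<alpha> < ereal K" "0 < part_diam X \<alpha>" "0 < part_gap X \<alpha>"
  shows "part_diam X \<alpha> powr K \<le> part_gap X \<alpha>"
proof -
  have lt: "part_diam X \<alpha> < 1" "ln (part_gap X \<alpha>) / ln (part_diam X \<alpha>) < K"
    using assms by (auto simp: part_log_ratio_def split: if_splits)
  then have "K * ln (part_diam X \<alpha>) \<le> ln (part_gap X \<alpha>)"
    using assms(2) by (simp add: divide_less_eq)
  then show ?thesis
    using assms(2,3) by (metis exp_le_cancel_iff exp_ln less_numeral_extra(3) powr_def)
qed

section \<open>Finiteness of the logarithmic ratio\<close>

text \<open>A bound on \<open>log_ratio_below X r\<close> for every positive \<open>r\<close> passes
  to the limit, which exists by \<open>log_ratio_tendsto\<close>.\<close>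

lemma log_ratio_le:
  assumes "\<And>r. r > 0 \<Longrightarrow> \<exists>\<alpha>. clopen_partition X \<alpha> \<and> part_diam X \<alpha> < r \<and> part_log_ratio X \<alpha> \<le> K"
  shows "log_ratio X \<le> K"
proof (rule tendsto_upperbound[OF log_ratio_tendsto])
  show "\<forall>\<^sub>F r in at_right 0. log_ratio_below X r \<le> K"
    using eventually_at_right_less[of "0::real"]
  proof eventually_elim
    case (elim r)
    with assms obtain \<alpha> where
      "clopen_partition X \<alpha>" "part_diam X \<alpha> < r" "part_log_ratio X \<alpha> \<le> K"
      by blast
    then show ?case
      unfolding log_ratio_below_def by (intro INF_lower2[of \<alpha>]) auto
  qed
qed simp

lemma bi_hoelder_bounds:
  assumes "bi_hoelder X Y f"
  obtains s c t C where "s > 0" "c > 0" "t > 0" "C > 0"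
    "\<And>x y. \<lbrakk>x \<in> mspace X; y \<in> mspace X\<rbrakk> \<Longrightarrow> mdist Y (f x) (f y) \<le> c * mdist X x y powr s"
    "\<And>x y. \<lbrakk>x \<in> mspace X; y \<in> mspace X\<rbrakk> \<Longrightarrow> mdist X x y \<le> C * mdist Y (f x) (f y) powr t"
proof -
  obtain s where "hoelder_map X Y s f"
    using assms by (auto simp: bi_hoelder_def)
  then obtain c where c: "s > 0" "c > 0" "f \<in> mspace X \<rightarrow> mspace Y"
    "\<And>x y. \<lbrakk>x \<in> mspace X; y \<in> mspace X\<rbrakk> \<Longrightarrow> mdist Y (f x) (f y) \<le> c * mdist X x y powr s"
    by (auto simp: hoelder_map_def)
  obtain t where "hoelder_map (submetric Y (f ` mspace X)) X t (inv_into (mspace X) f)"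
    using assms by (auto simp: bi_hoelder_def)
  then obtain C where C: "t > 0" "C > 0"
    "\<And>u v. \<lbrakk>u \<in> f ` mspace X \<inter> mspace Y; v \<in> f ` mspace X \<inter> mspace Y\<rbrakk> \<Longrightarrow>
       mdist X (inv_into (mspace X) f u) (inv_into (mspace X) f v) \<le> C * mdist Y u v powr t"
    by (auto simp: hoelder_map_def)
  have inj: "inj_on f (mspace X)"
    using assms by (auto simp: bi_hoelder_def)
  have lower: "mdist X x y \<le> C * mdist Y (f x) (f y) powr t"
    if "x \<in> mspace X" "y \<in> mspace X" for x y
    \<comment> \<open>The carrier of the submetric is an intersection with \<open>mspace Y\<close>;
      \<open>c(3)\<close> places \<open>f x\<close> and \<open>f y\<close> in it.\<close>
    using C(3)[of "f x" "f y"] that c(3) inj by auto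
  show ?thesis
    by (rule that[OF c(1,2) C(1,2) c(4) lower])
qed

text \<open>Transitivity is the ultrametric inequality. The classes are the nonempty preimages under
  \<open>f\<close> of open \<open>e\<close>-balls centred in the image.\<close>

lemma ultrametric_ball_equiv:
  assumes "ultrametric Y" "f \<in> M \<rightarrow> mspace Y" "e > 0"
  shows "equiv M {(x, y). x \<in> M \<and> y \<in> M \<and> mdist Y (f x) (f y) < e}"
proof (rule equivI)
  show "trans {(x, y). x \<in> M \<and> y \<in> M \<and> mdist Y (f x) (f y) < e}"
  proof (rule transI, clarify)
    fix x y z
    assume "x \<in> M" "y \<in> M" "z \<in> M"
      and *: "mdist Y (f x) (f y) < e" "mdist Y (f y) (f z) < e"
    then have "mdist Y (f x) (f z) \<le> max (mdist Y (f x) (f y)) (mdist Y (f z) (f y))"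
      using assms(1,2) unfolding ultrametric_def by (simp add: Pi_iff)
    with * show "mdist Y (f x) (f z) < e"
      by (simp add: mdist_commute[of Y "f z"])
  qed
  show "refl_on M {(x, y). x \<in> M \<and> y \<in> M \<and> mdist Y (f x) (f y) < e}"
    using assms(2,3) by (auto simp: refl_on_def Pi_iff)
qed (auto simp: sym_def mdist_commute)

text \<open>The partition consists of preimages of \<open>e\<close>-balls of \<open>Y\<close>. Its
  diameter is at most \<open>C * e powr t\<close> and its gap at least
  \<open>(e / c) powr (1 / s)\<close>. Both are powers of the same \<open>e\<close>, so one exponent
  \<open>K\<close> compares them for all small \<open>e\<close>. With a single class,
  \<open>part_gap\<close> is only a default value, hence the condition on
  \<open>card\<close>.\<close>

lemma small_clopen_partition:
  assumes "compact_space (mtopology_of X)" "ultrametric Y" "bi_hoelder X Y f"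
  obtains K where "\<And>r. r > 0 \<Longrightarrow> \<exists>\<alpha>. clopen_partition X \<alpha> \<and> part_diam X \<alpha> < r \<and>
    (card \<alpha> > 1 \<longrightarrow> part_diam X \<alpha> powr K \<le> part_gap X \<alpha>)"
proof -
  obtain s c t C where pos: "s > 0" "c > 0" "t > 0" "C > 0"
    and up: "\<And>x y. \<lbrakk>x \<in> mspace X; y \<in> mspace X\<rbrakk> \<Longrightarrow> mdist Y (f x) (f y) \<le> c * mdist X x y powr s"
    and lo: "\<And>x y. \<lbrakk>x \<in> mspace X; y \<in> mspace X\<rbrakk> \<Longrightarrow> mdist X x y \<le> C * mdist Y (f x) (f y) powr t"
    using bi_hoelder_bounds[OF assms(3)] by blast
  have fY: "f \<in> mspace X \<rightarrow> mspace Y"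
    using assms(3) by (auto simp: bi_hoelder_def hoelder_map_def)
  \<comment> \<open>Any exponent above \<open>1 / (s * t)\<close> would do.\<close>
  define K where "K = 2 / (s * t)"
  have "\<exists>\<alpha>. clopen_partition X \<alpha> \<and> part_diam X \<alpha> < r \<and>
    (card \<alpha> > 1 \<longrightarrow> part_diam X \<alpha> powr K \<le> part_gap X \<alpha>)" if "r > 0" for r
  proof -
    have "((\<lambda>e. C * e powr t) \<longlongrightarrow> C * 0 powr t) (at_right 0)"
      using pos by (intro tendsto_intros tendsto_powr' tendsto_ident_at) (auto simp: eventually_at_filter)
    then have 1: "\<forall>\<^sub>F e in at_right 0. C * e powr t < r"
      using pos \<open>r > 0\<close> by (intro order_tendstoD(2)) auto
    \<comment> \<open>As \<open>t * K = 2 / s\<close>, the power \<open>(e powr t) powr K\<close>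
      splits into two factors \<open>e powr (1 / s)\<close>. For small \<open>e\<close>, one of them
      absorbs the constants \<open>C\<close> and \<open>c\<close>.\<close>
    have "((\<lambda>e. C powr K * e powr (1 / s)) \<longlongrightarrow> C powr K * 0 powr (1 / s)) (at_right 0)"
      using pos by (intro tendsto_intros tendsto_powr' tendsto_ident_at) (auto simp: eventually_at_filter)
    then have 2: "\<forall>\<^sub>F e in at_right 0. C powr K * e powr (1 / s) < (1 / c) powr (1 / s)"
      using pos by (intro order_tendstoD(2)) auto
    obtain e where e: "e > 0" "C * e powr t < r" "C powr K * e powr (1 / s) < (1 / c) powr (1 / s)"
      using eventually_happens[OF eventually_conj[OF eventually_at_right_less[of 0] eventually_conj[OF 1 2]]]
      by auto
    define R where "R = {(x, y). x \<in> mspace X \<and> y \<in> mspace X \<and> mdist Y (f x) (f y) < e}"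
    have eq: "equiv (mspace X) R"
      unfolding R_def using assms(2) fY e(1) by (rule ultrametric_ball_equiv)
    have sep: "(e / c) powr (1 / s) \<le> mdist X x y"
      if "x \<in> mspace X" "y \<in> mspace X" "(x, y) \<notin> R" for x y
    proof -
      have "e \<le> c * mdist X x y powr s"
        using up[OF that(1,2)] that by (auto simp: R_def)
      then have "e / c \<le> mdist X x y powr s"
        using pos by (simp add: field_simps)
      then have "(e / c) powr (1 / s) \<le> (mdist X x y powr s) powr (1 / s)"
        using pos e(1) by (intro powr_mono2) auto
      then show ?thesis
        using pos by (simp add: powr_powr)
    qed
    have cp: "clopen_partition X (mspace X // R)"
    proof (rule clopen_partition_quotient[OF assms(1) eq])
      show "(e / c) powr (1 / s) > 0"
        using pos e(1) by simp
      show "(x, y) \<in> R"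
        if "x \<in> mspace X" "y \<in> mspace X" "mdist X x y < (e / c) powr (1 / s)" for x y
        using sep that by fastforce
    qed
    have diam: "part_diam X (mspace X // R) \<le> C * e powr t"
    proof (rule part_diam_le)
      show "finite (mspace X // R)"
        using cp by (simp add: clopen_partition_def)
      fix A x y assume "A \<in> mspace X // R" "x \<in> A" "y \<in> A"
      then have "(x, y) \<in> R"
        using eq by (metis in_quotient_imp_in_rel empty_subsetI insert_subset)
      then have R: "x \<in> mspace X" "y \<in> mspace X" "mdist Y (f x) (f y) < e"
        by (auto simp: R_def)
      then have "mdist X x y \<le> C * mdist Y (f x) (f y) powr t"
        using lo by blast
      also have "\<dots> \<le> C * e powr t"
        using R pos by (intro mult_left_mono powr_mono2) auto
      finally show "mdist X x y \<le> C * e powr t" .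
    qed (use pos in auto)
    have "part_diam X (mspace X // R) powr K \<le> part_gap X (mspace X // R)"
      if "card (mspace X // R) > 1"
    proof -
      have "part_diam X (mspace X // R) powr K \<le> (C * e powr t) powr K"
        using diam part_diam_nonneg[OF assms(1) cp] pos by (intro powr_mono2) (auto simp: K_def)
      also have "\<dots> = C powr K * e powr (1 / s) * e powr (1 / s)"
        using pos e(1) by (simp add: powr_mult powr_powr K_def flip: powr_add)
      also have "\<dots> \<le> (1 / c) powr (1 / s) * e powr (1 / s)"
        using e by (intro mult_right_mono) auto
      also have "\<dots> = (e / c) powr (1 / s)"
        using pos e(1) by (simp flip: powr_mult)
      also have "\<dots> \<le> part_gap X (mspace X // R)"
      proof (rule part_gap_ge)
        show "partition_on (mspace X) (mspace X // R)"
          using eq by (rule partition_on_quotient)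
        fix A B x y
        assume *: "A \<in> mspace X // R" "B \<in> mspace X // R" "A \<noteq> B" "x \<in> A" "y \<in> B"
        then have "(x, y) \<notin> R"
          using eq by (metis quotient_eq_iff)
        then show "(e / c) powr (1 / s) \<le> mdist X x y"
          using sep * clopen_partition_subset[OF cp] by blast
      qed (rule that)
      finally show ?thesis .
    qed
    with cp diam e(2) show ?thesis
      by force
  qed
  with that show ?thesis
    by blast
qed

text \<open>The power bound is already available; what remains is to keep the ratio away from its
  default value \<open>\<infinity>\<close>, which requires partitions with more than one cell and
  gap below 1.\<close>

lemma log_ratio_finite_of_ultrametric:
  assumes "compact_space (mtopology_of X)" "ultrametric Y" "bi_hoelder X Y f"
  shows "log_ratio X < \<infinity>"
proof -
  obtain K where K: "\<And>r. r > 0 \<Longrightarrow> \<exists>\<alpha>. clopen_partition X \<alpha> \<and> part_diam X \<alpha> < r \<and>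
    (card \<alpha> > 1 \<longrightarrow> part_diam X \<alpha> powr K \<le> part_gap X \<alpha>)"
    using small_clopen_partition[OF assms] by blast
  show ?thesis
  proof (cases "\<exists>\<alpha>. clopen_partition X \<alpha> \<and> part_diam X \<alpha> = 0")
    \<comment> \<open>A partition of diameter 0 is admissible for every \<open>r\<close> and has
      ratio 0 by convention.\<close>
    case True
    then have "log_ratio X \<le> 0"
      by (intro log_ratio_le) (auto simp: part_log_ratio_def)
    then show ?thesis
      by (auto intro: le_less_trans)
  next
    case False
    then have pos: "part_diam X \<alpha> > 0" if "clopen_partition X \<alpha>" for \<alpha>
      using part_diam_nonneg[OF assms(1) that] that by force
    obtain \<alpha>0 where \<alpha>0: "clopen_partition X \<alpha>0" "part_diam X \<alpha>0 < 1"
      using K[of 1] by auto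
    \<comment> \<open>Two distinct points of one cell of \<open>\<alpha>0\<close> have distance
      strictly between 0 and 1. Every partition that separates them therefore has gap below
      1.\<close>
    have "\<exists>A x y. A \<in> \<alpha>0 \<and> x \<in> A \<and> y \<in> A \<and> x \<noteq> y"
    proof (rule ccontr)
      assume "\<not> ?thesis"
      then have "part_diam X \<alpha>0 \<le> 0"
        using \<alpha>0(1) clopen_partition_subset[OF \<alpha>0(1)]
        by (intro part_diam_le) (auto simp: clopen_partition_def, metis mdist_zero order_refl subsetD)
      with pos[OF \<alpha>0(1)] show False
        by simp
    qed
    then obtain A x y where xy: "A \<in> \<alpha>0" "x \<in> A" "y \<in> A" "x \<noteq> y"
      by blast
    have M: "x \<in> mspace X" "y \<in> mspace X"
      using xy clopen_partition_subset[OF \<alpha>0(1)] by blast+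
    have lt1: "mdist X x y < 1"
      using mdist_le_part_diam[OF assms(1) \<alpha>0(1) xy(1-3)] \<alpha>0(2) by simp
    have xy_pos: "mdist X x y > 0"
      using M xy(4) mdist_zero[OF M] mdist_nonneg[of X x y] by linarith
    have "log_ratio X \<le> ereal K"
    proof (rule log_ratio_le)
      fix r :: real assume "r > 0"
      \<comment> \<open>A diameter below \<open>mdist X x y\<close> forces \<open>x\<close> and
        \<open>y\<close> into different cells.\<close>
      with xy_pos obtain \<alpha> where \<alpha>: "clopen_partition X \<alpha>" "part_diam X \<alpha> < min r (mdist X x y)"
        "card \<alpha> > 1 \<longrightarrow> part_diam X \<alpha> powr K \<le> part_gap X \<alpha>"
        using K[of "min r (mdist X x y)"] by auto
      obtain A B where AB: "A \<in> \<alpha>" "B \<in> \<alpha>" "x \<in> A" "y \<in> B"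
        using clopen_partition_cover[OF \<alpha>(1) M(1)] clopen_partition_cover[OF \<alpha>(1) M(2)] by metis
      have ne: "A \<noteq> B"
        using mdist_le_part_diam[OF assms(1) \<alpha>(1), of A x y] AB \<alpha>(2) by auto
      have fin: "finite \<alpha>"
        using \<alpha>(1) by (simp add: clopen_partition_def)
      have "card \<alpha> > 1"
        using card_gt_1I[OF fin AB(1,2) ne] .
      moreover have "part_gap X \<alpha> < 1"
        using part_gap_le_mdist[OF fin AB(1,2) ne AB(3,4), of X] lt1 by simp
      ultimately have "part_log_ratio X \<alpha> \<le> ereal K"
        using \<alpha> lt1 pos[OF \<alpha>(1)] by (intro part_log_ratio_le) auto
      with \<alpha> show "\<exists>\<alpha>. clopen_partition X \<alpha> \<and> part_diam X \<alpha> < r \<and> part_log_ratio X \<alpha> \<le> ereal K"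
        by auto
    qed
    then show ?thesis
      by (auto intro: le_less_trans)
  qed
qed

section \<open>Ultrametrics from sequences of equivalence relations\<close>

lemma bi_hoelder_equivalent_id:
  assumes "mspace Y = mspace X" "s > 0" "c > 0" "t > 0" "C > 0"
    and "\<And>x y. \<lbrakk>x \<in> mspace X; y \<in> mspace X\<rbrakk> \<Longrightarrow> mdist Y x y \<le> c * mdist X x y powr s"
    and "\<And>x y. \<lbrakk>x \<in> mspace X; y \<in> mspace X\<rbrakk> \<Longrightarrow> mdist X x y \<le> C * mdist Y x y powr t"
  shows "bi_hoelder_equivalent X Y"
proof -
  have inv: "inv_into (mspace X) (\<lambda>x. x) x = x" if "x \<in> mspace X" for x
    using that by (simp add: inv_into_f_eq)
  have "hoelder_map X Y s (\<lambda>x. x)"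
    using assms by (auto simp: hoelder_map_def)
  moreover have "hoelder_map (submetric Y (mspace X)) X t (inv_into (mspace X) (\<lambda>x. x))"
    using assms by (auto simp: hoelder_map_def inv)
  ultimately have "bi_hoelder_equivalence X Y (\<lambda>x. x)"
    using assms by (auto simp: bi_hoelder_equivalence_def bi_hoelder_def)
  then show ?thesis
    unfolding bi_hoelder_equivalent_def by blast
qed

text \<open>The model is the metric on sequences given by the first index of disagreement, with
  \<open>w\<close> supplying the value at that index. \<open>LEAST\<close> carries no information on
  a pair that is never separated.\<close>

definition separation_dist :: "'a set \<Rightarrow> (nat \<Rightarrow> ('a \<times> 'a) set) \<Rightarrow> (nat \<Rightarrow> real) \<Rightarrow> 'a \<Rightarrow> 'a \<Rightarrow> real" where
  "separation_dist M E w x y =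
     (if x \<in> M \<and> y \<in> M \<and> x \<noteq> y then w (LEAST n. (x, y) \<notin> E n) else 0)"

lemma separation_dist_commute:
  assumes "\<And>n. equiv M (E n)"
  shows "separation_dist M E w x y = separation_dist M E w y x"
proof -
  have "(x, y) \<in> E n \<longleftrightarrow> (y, x) \<in> E n" for n
    using assms[of n] by (meson equivE symE)
  then show ?thesis
    by (auto simp: separation_dist_def)
qed

text \<open>If \<open>E m\<close> separates \<open>x\<close> from \<open>y\<close>, transitivity
  makes it separate \<open>z\<close> from one of them. That pair is first separated at an index at
  most \<open>m\<close>, where the decreasing weight is at least \<open>w m\<close>.\<close>

lemma separation_dist_ultra:
  assumes "\<And>n. equiv M (E n)" "\<And>n. w n > 0" "decseq w"
    and "\<And>x y. \<lbrakk>x \<in> M; y \<in> M; x \<noteq> y\<rbrakk> \<Longrightarrow> \<exists>n. (x, y) \<notin> E n"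
    and M: "x \<in> M" "y \<in> M" "z \<in> M"
  shows "separation_dist M E w x y \<le> max (separation_dist M E w x z) (separation_dist M E w y z)"
proof (cases "x = y \<or> x = z \<or> y = z")
  case True
  moreover have "0 \<le> separation_dist M E w x z" "separation_dist M E w x x = 0"
    using less_imp_le[OF assms(2)] by (auto simp: separation_dist_def)
  ultimately show ?thesis
    using separation_dist_commute[where E=E and w=w and x=x and y=y, OF assms(1)] by auto
next
  case False
  define m where "m = (LEAST n. (x, y) \<notin> E n)"
  have "(x, y) \<notin> E m"
    unfolding m_def using assms(4) M False by (metis LeastI_ex)
  then have "(x, z) \<notin> E m \<or> (y, z) \<notin> E m"
    using assms(1)[of m] by (meson equivE symE transE)
  then have "(LEAST n. (x, z) \<notin> E n) \<le> m \<or> (LEAST n. (y, z) \<notin> E n) \<le> m"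
    by (metis (mono_tags, lifting) Least_le)
  then have "w m \<le> w (LEAST n. (x, z) \<notin> E n) \<or> w m \<le> w (LEAST n. (y, z) \<notin> E n)"
    using assms(3) by (auto simp: decseq_def)
  with False M show ?thesis
    by (auto simp: separation_dist_def m_def)
qed

lemma Metric_space_separation_dist:
  assumes "\<And>n. equiv M (E n)" "\<And>n. w n > 0" "decseq w"
    and "\<And>x y. \<lbrakk>x \<in> M; y \<in> M; x \<noteq> y\<rbrakk> \<Longrightarrow> \<exists>n. (x, y) \<notin> E n"
  shows "Metric_space M (separation_dist M E w)"
proof
  show nonneg: "0 \<le> separation_dist M E w x y" for x y
    using less_imp_le[OF assms(2)] by (simp add: separation_dist_def)
  show commute: "separation_dist M E w x y = separation_dist M E w y x" for x y
    using assms(1) by (rule separation_dist_commute)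
  show "separation_dist M E w x y = 0 \<longleftrightarrow> x = y" if "x \<in> M" "y \<in> M" for x y
    using that less_imp_neq[OF assms(2)] by (auto simp: separation_dist_def)
  show "separation_dist M E w x z \<le> separation_dist M E w x y + separation_dist M E w y z"
    if "x \<in> M" "y \<in> M" "z \<in> M" for x y z
    using separation_dist_ultra[where E=E and w=w, OF assms that(1,3,2)]
      nonneg[of x y] nonneg[of y z] commute[of y z] by auto
qed

text \<open>Let \<open>m\<close> be the first index separating \<open>x\<close> and
  \<open>y\<close>. Then \<open>up\<close> at \<open>m\<close> bounds the new distance
  \<open>w m\<close> by the old one, and \<open>lo\<close> at \<open>m - 1\<close> bounds the old
  one by the new.\<close>

lemma bi_hoelder_equivalent_ultrametric_of_separation:
  fixes X :: "'a metric"
  assumes eq: "\<And>n. equiv (mspace X) (E n)" and w: "\<And>n. w n > 0" "decseq w"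
    and sep: "\<And>x y. \<lbrakk>x \<in> mspace X; y \<in> mspace X; x \<noteq> y\<rbrakk> \<Longrightarrow> \<exists>n. (x, y) \<notin> E n"
    and pos: "s > 0" "c > 0" "t > 0" "C > 0"
    and up: "\<And>n x y. \<lbrakk>x \<in> mspace X; y \<in> mspace X; (x, y) \<notin> E n\<rbrakk> \<Longrightarrow> w n \<le> c * mdist X x y powr s"
    and lo: "\<And>n x y. (x, y) \<in> E n \<Longrightarrow> mdist X x y \<le> C * w (Suc n) powr t"
    and bound: "\<And>x y. \<lbrakk>x \<in> mspace X; y \<in> mspace X\<rbrakk> \<Longrightarrow> mdist X x y \<le> D"
  shows "\<exists>Y :: 'a metric. ultrametric Y \<and> bi_hoelder_equivalent X Y"
proof -
  let ?d = "separation_dist (mspace X) E w"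
  interpret S: Metric_space "mspace X" ?d
    using eq w sep by (rule Metric_space_separation_dist)
  define Y where "Y = metric (mspace X, ?d)"
  have Y: "mspace Y = mspace X" "mdist Y = ?d"
    by (simp_all add: Y_def)
  have "ultrametric Y"
    unfolding ultrametric_def Y using separation_dist_ultra[where E=E and w=w, OF eq w sep] by blast
  \<comment> \<open>For pairs separated already at index 0 there is no earlier index to which
    \<open>lo\<close> applies; the second entry handles them through the global bound
    \<open>D\<close>.\<close>
  define C' where "C' = max C (D / w 0 powr t)"
  have "C' > 0"
    using pos by (simp add: C'_def)
  have "bi_hoelder_equivalent X Y"
  proof (rule bi_hoelder_equivalent_id[OF Y(1) pos(1-3) \<open>C' > 0\<close>])
    fix x y assume M: "x \<in> mspace X" "y \<in> mspace X"
    define m where "m = (LEAST n. (x, y) \<notin> E n)"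
    have m: "(x, y) \<notin> E m" if "x \<noteq> y"
      unfolding m_def using sep M that by (metis LeastI_ex)
    show "mdist Y x y \<le> c * mdist X x y powr s"
      using M up[OF M m] pos(2) by (auto simp: Y separation_dist_def m_def)
    show "mdist X x y \<le> C' * mdist Y x y powr t"
    proof (cases "x = y")
      case False
      have "mdist X x y \<le> C' * w m powr t"
      proof (cases m)
        case 0
        have "mdist X x y \<le> D / w 0 powr t * w 0 powr t"
          using bound[OF M] w(1)[of 0] by simp
        also have "\<dots> \<le> C' * w 0 powr t"
          by (intro mult_right_mono) (auto simp: C'_def)
        finally show ?thesis
          using 0 by simp
      next
        case (Suc k)
        then have "(x, y) \<in> E k"
          using not_less_Least[of k "\<lambda>n. (x, y) \<notin> E n"] by (auto simp: m_def)
        then have "mdist X x y \<le> C * w m powr t"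
          using lo Suc by simp
        also have "\<dots> \<le> C' * w m powr t"
          by (intro mult_right_mono) (auto simp: C'_def)
        finally show ?thesis .
      qed
      then show ?thesis
        using M False by (simp add: Y separation_dist_def m_def)
    qed (use M in \<open>simp add: Y separation_dist_def\<close>)
  qed
  with \<open>ultrametric Y\<close> show ?thesis
    by blast
qed

section \<open>From a sequence in \<open>A_star\<close> to an ultrametric\<close>

lemma ultrametric_of_A_star:
  fixes X :: "'a metric"
  assumes cpt: "compact_space (mtopology_of X)"
    and fin: "log_ratio X < \<infinity>" and p: "p > 1" and \<alpha>: "\<alpha> \<in> A_star p X"
  shows "\<exists>Y :: 'a metric. ultrametric Y \<and> bi_hoelder_equivalent X Y"
proof -
  obtain D where bound: "\<And>x y. \<lbrakk>x \<in> mspace X; y \<in> mspace X\<rbrakk> \<Longrightarrow> mdist X x y \<le> D"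
    using mdist_bounded_of_compact[OF cpt] by blast
  define E where "E n = {(x, y). \<exists>A\<in>\<alpha> n. x \<in> A \<and> y \<in> A}" for n
  have cp: "clopen_partition X (\<alpha> n)" for n
    using \<alpha> by (auto simp: A_star_def)
  have eq: "equiv (mspace X) (E n)" for n
    unfolding E_def using cp by (intro equiv_partition_on) (auto simp: clopen_partition_def)
  have near: "mdist X x y \<le> part_diam X (\<alpha> n)" if "(x, y) \<in> E n" for n x y
    using that mdist_le_part_diam[OF cpt cp] by (auto simp: E_def)
  have far: "0 < part_gap X (\<alpha> n) \<and> part_gap X (\<alpha> n) \<le> mdist X x y"
    if xy: "x \<in> mspace X" "y \<in> mspace X" "(x, y) \<notin> E n" for n x y
  proof -
    obtain A B where AB: "A \<in> \<alpha> n" "x \<in> A" "B \<in> \<alpha> n" "y \<in> B"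
      using clopen_partition_cover[OF cp[of n] xy(1)] clopen_partition_cover[OF cp[of n] xy(2)] by metis
    with xy(3) have ne: "A \<noteq> B"
      by (auto simp: E_def)
    have fin: "finite (\<alpha> n)"
      using cp by (simp add: clopen_partition_def)
    show ?thesis
      using part_gap_pos[OF cpt cp card_gt_1I[OF fin AB(1,3) ne]]
        part_gap_le_mdist[OF fin AB(1,3) ne AB(2,4)] by blast
  qed
  show ?thesis
  proof (cases "\<exists>n. part_diam X (\<alpha> n) = 0")
    \<comment> \<open>All cells of \<open>\<alpha> n\<close> are singletons, so the space is finite.
      The constant family \<open>E n\<close> with weight 1 yields the discrete metric.\<close>
    case True
    then obtain n where n: "part_diam X (\<alpha> n) = 0"
      by blast
    have eq0: "mdist X x y = 0" if "(x, y) \<in> E n" for x y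
      using near[OF that] n mdist_nonneg[of X x y] by linarith
    have gap: "1 \<le> 1 / \<bar>part_gap X (\<alpha> n)\<bar> * mdist X x y powr 1"
      if "x \<in> mspace X" "y \<in> mspace X" "(x, y) \<notin> E n" for x y
      using far[OF that] by (simp add: field_simps)
    \<comment> \<open>The summand \<open>1\<close> covers spaces with at most one point, whose gap is \<open>0\<close>.\<close>
    show ?thesis
    proof (rule bi_hoelder_equivalent_ultrametric_of_separation
        [where E = "\<lambda>_. E n" and w = "\<lambda>_. 1" and s = 1 and t = 1 and C = 1 and D = D
          and c = "1 + 1 / \<bar>part_gap X (\<alpha> n)\<bar>"])
      show "\<exists>k. (x, y) \<notin> E n" if "x \<in> mspace X" "y \<in> mspace X" "x \<noteq> y" for x y
        using eq0 that by (metis mdist_zero)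
      show "1 \<le> (1 + 1 / \<bar>part_gap X (\<alpha> n)\<bar>) * mdist X x y powr 1"
        if "x \<in> mspace X" "y \<in> mspace X" "(x, y) \<notin> E n" for x y
        using gap[OF that] by (simp add: ring_distribs add_increasing)
      show "0 < 1 + 1 / \<bar>part_gap X (\<alpha> n)\<bar>"
        by (intro add_pos_nonneg) auto
    qed (use eq eq0 bound in \<open>auto simp: decseq_def\<close>)
  next
    case False
    then have dpos: "part_diam X (\<alpha> n) > 0" for n
      using part_diam_nonneg[OF cpt cp, of n] by (metis less_eq_real_def)
    have d0: "(\<lambda>n. part_diam X (\<alpha> n)) \<longlonglongrightarrow> 0"
      using \<alpha> by (auto simp: A_star_def)
    obtain a where a: "a > 0" "\<And>n. a * part_diam X (\<alpha> n) powr p \<le> part_diam X (\<alpha> (Suc n))"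
      "\<And>n. part_diam X (\<alpha> (Suc n)) \<le> part_diam X (\<alpha> n)"
      using \<alpha> by (auto simp: A_star_def)
    \<comment> \<open>Positivity of \<open>K\<close> is needed because \<open>1 / K\<close> becomes
      a Hoelder exponent.\<close>
    obtain K :: real where K: "K > 0" "log_ratio X < ereal K"
    proof -
      have "max (log_ratio X) 0 < \<infinity>"
        using fin by (simp add: max_def)
      then obtain K where "max (log_ratio X) 0 < ereal K"
        by (meson ereal_dense2)
      with that show ?thesis
        by auto
    qed
    have "(\<lambda>n. part_log_ratio X (\<alpha> n)) \<longlonglongrightarrow> log_ratio X"
      using \<alpha> by (auto simp: A_star_def)
    then have "\<forall>\<^sub>F n in sequentially. part_log_ratio X (\<alpha> n) < ereal K"
      using K(2) by (rule order_tendstoD)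
    then obtain N where N: "\<And>n. n \<ge> N \<Longrightarrow> part_log_ratio X (\<alpha> n) < ereal K"
      by (auto simp: eventually_sequentially)
    \<comment> \<open>The ratio is known to be below \<open>K\<close> only from \<open>N\<close> on,
      so the sequence is restarted there.\<close>
    define w where "w n = part_diam X (\<alpha> (n + N))" for n
    show ?thesis
    proof (rule bi_hoelder_equivalent_ultrametric_of_separation
        [where E = "\<lambda>n. E (n + N)" and w = w and s = "1 / K" and c = 1
          and t = "1 / p" and C = "(1 / a) powr (1 / p)" and D = D])
      show "decseq w"
        using a(3) by (intro decseq_SucI) (simp add: w_def)
      show "\<exists>n. (x, y) \<notin> E (n + N)" if "x \<in> mspace X" "y \<in> mspace X" "x \<noteq> y" for x y
      proof -
        have "mdist X x y > 0"
          using that by (metis mdist_nonneg mdist_zero less_eq_real_def)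
        with d0 have "\<forall>\<^sub>F n in sequentially. part_diam X (\<alpha> n) < mdist X x y"
          by (intro order_tendstoD)
        then obtain k where "\<And>n. n \<ge> k \<Longrightarrow> part_diam X (\<alpha> n) < mdist X x y"
          by (auto simp: eventually_sequentially)
        then have "part_diam X (\<alpha> (k + N)) < mdist X x y"
          by simp
        with near[of x y "k + N"] show ?thesis
          by force
      qed
      show "w n \<le> 1 * mdist X x y powr (1 / K)"
        if "x \<in> mspace X" "y \<in> mspace X" "(x, y) \<notin> E (n + N)" for n x y
      proof -
        have "w n powr K \<le> part_gap X (\<alpha> (n + N))"
          unfolding w_def using N dpos far[OF that] by (intro powr_le_part_gap) auto
        also have "\<dots> \<le> mdist X x y"
          using far[OF that] by simp
        finally have "(w n powr K) powr (1 / K) \<le> mdist X x y powr (1 / K)"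
          using K by (intro powr_mono2) auto
        then show ?thesis
          using K dpos[of "n + N"] by (simp add: powr_powr w_def)
      qed
      show "mdist X x y \<le> (1 / a) powr (1 / p) * w (Suc n) powr (1 / p)"
        if "(x, y) \<in> E (n + N)" for n x y
      proof -
        have "mdist X x y \<le> w n"
          using near[OF that] by (simp add: w_def)
        also have "\<dots> = (w n powr p) powr (1 / p)"
          using p dpos[of "n + N"] by (simp add: powr_powr w_def)
        \<comment> \<open>This is where diameters must not shrink too fast: the condition with
          \<open>a\<close> and \<open>p\<close> in \<open>A_star\<close> is solved for
          \<open>w n powr p\<close>.\<close>
        also have "\<dots> \<le> (1 / a * w (Suc n)) powr (1 / p)"
          using a(1) a(2)[of "n + N"] p by (intro powr_mono2) (auto simp: w_def field_simps)
        also have "\<dots> = (1 / a) powr (1 / p) * w (Suc n) powr (1 / p)"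
          by (rule powr_mult)
        finally show ?thesis .
      qed
    qed (use eq dpos K a(1) p bound in \<open>auto simp: w_def\<close>)
  qed
qed

text \<open>In the first part the ultrametric space may live on any type \<open>'b\<close>. In the
  second it is a new metric on the points of \<open>X\<close>, hence the type
  \<open>'a metric\<close>.\<close>

theorem theorem2p6:
  fixes X :: "'a metric"
  assumes "compact_space (mtopology_of X)"
    and "mdiameter X (mspace X) \<le> 1"
  shows "((\<exists>Y :: 'b metric. ultrametric Y \<and> bi_hoelder_equivalent X Y) \<longrightarrow> log_ratio X < \<infinity>) \<and>
         (log_ratio X < \<infinity> \<and> (\<exists>p>1. A_star p X \<noteq> {}) \<longrightarrow>
            (\<exists>Y :: 'a metric. ultrametric Y \<and> bi_hoelder_equivalent X Y))"
proof (intro conjI impI)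
  assume "\<exists>Y :: 'b metric. ultrametric Y \<and> bi_hoelder_equivalent X Y"
  then obtain Y :: "'b metric" and f where "ultrametric Y" "bi_hoelder X Y f"
    by (auto simp: bi_hoelder_equivalent_def bi_hoelder_equivalence_def)
  then show "log_ratio X < \<infinity>"
    using log_ratio_finite_of_ultrametric[OF assms(1)] by blast
next
  assume "log_ratio X < \<infinity> \<and> (\<exists>p>1. A_star p X \<noteq> {})"
  then show "\<exists>Y :: 'a metric. ultrametric Y \<and> bi_hoelder_equivalent X Y"
    using ultrametric_of_A_star[OF assms(1)] by blast
qed

end
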